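(* For every integer $n\ge 2$, the silicate network satisfies $\beta'(SL(n))=12n$.
   Context: Let $H_n$ be the $n$-th circumcoronene (honeycomb) graph: a central hexagon surrounded by $n-1$ layers of hexagons; its boundary contains exactly $6n$ vertices of degree $2$. The silicate network $SL(n)$ is obtained as follows: call the vertices of $H_n$ silicon vertices; subdivide every edge of $H_n$ once, calling the new vertices oxygen vertices; at each of the $6n$ degree-2 silicon vertices attach one new pendant oxygen vertex; finally, for every silicon vertex, its three adjacent oxygen vertices are made pairwise adjacent (so each silicon vertex together with its three oxygen neighbours induces $K_4$). For a connected graph $G$, a set $S\subseteq V(G)$ is a resolving set if for every pair of distinct vertices $a,b$ there is $u\in S$ with $d(a,u)\neq d(b,u)$ ($d$ the shortest-path distance); $S$ is a fault-tolerant resolving set if $S\setminus\{x\}$ is a resolving set for every $x\in S$; $\beta'(G)$ is the minimum cardinality of a fault-tolerant resolving set of $G$. *)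

theory Defs
  imports "Graph_Theory.Graph_Theory"
begin

section \<open>Fault-tolerant metric dimension\<close>

text \<open>
  An undirected simple graph is a symmetric, loop-free digraph with pairs as arcs, as in the
  library locale \<^locale>\<open>pair_graph\<close>.
\<close>

definition graph_dist :: "'a pair_pre_digraph \<Rightarrow> 'a \<Rightarrow> 'a \<Rightarrow> ereal" where
  "graph_dist G u v = wf_digraph.\<mu> (with_proj G) (\<lambda>_. 1) u v"

definition resolving_set :: "'a pair_pre_digraph \<Rightarrow> 'a set \<Rightarrow> bool" where
  "resolving_set G S \<longleftrightarrow> S \<subseteq> pverts G \<and>
     (\<forall>a\<in>pverts G. \<forall>b\<in>pverts G. a \<noteq> b \<longrightarrow> (\<exists>u\<in>S. graph_dist G a u \<noteq> graph_dist G b u))"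

text \<open>
  The first conjunct excludes the empty set, for which the second one holds vacuously. For
  nonempty \<open>S\<close> it is implied by the second one together with \<open>S \<subseteq> pverts G\<close>.
\<close>

definition ft_resolving_set :: "'a pair_pre_digraph \<Rightarrow> 'a set \<Rightarrow> bool" where
  "ft_resolving_set G S \<longleftrightarrow> resolving_set G S \<and> (\<forall>x\<in>S. resolving_set G (S - {x}))"

definition ft_metric_dim :: "'a pair_pre_digraph \<Rightarrow> nat" where
  "ft_metric_dim G = (LEAST k. \<exists>S. finite S \<and> ft_resolving_set G S \<and> card S = k)"


section \<open>Circumcoronene graphs\<close>

text \<open>
  Coordinates for the infinite honeycomb: its vertices are the integer points with coordinate
  sum 1 or 2, two of them adjacent when they differ by one in exactly one coordinate (so every
  vertex has degree 3). The hexagonal faces correspond to the points \<open>c\<close> with coordinate sum 0: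
  the face of \<open>c\<close> is the 6-cycle on those points of the cube \<open>c + {0,1}\<^sup>3\<close> that
  are different from its corners \<open>c\<close> and \<open>c + (1,1,1)\<close>.
\<close>

type_synonym point = "int \<times> int \<times> int"

fun hexagon :: "point \<Rightarrow> point set" where
  "hexagon (a, b, c) =
     {(a + i, b + j, c + k) | i j k. i \<in> {0,1} \<and> j \<in> {0,1} \<and> k \<in> {0,1} \<and> i + j + k \<in> {1,2}}"

fun honeycomb_adj :: "point \<Rightarrow> point \<Rightarrow> bool" where
  "honeycomb_adj (x, y, z) (x', y', z') \<longleftrightarrow> \<bar>x - x'\<bar> + \<bar>y - y'\<bar> + \<bar>z - z'\<bar> = 1"

text \<open>
  A central hexagon surrounded by \<open>k\<close> layers: a layer consists of the faces that touch the
  previous patch (two faces sharing a vertex also share an edge).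
\<close>

primrec hexagon_patch :: "nat \<Rightarrow> point set" where
  "hexagon_patch 0 = {(0, 0, 0)}"
| "hexagon_patch (Suc k) =
     {(a, b, c) | a b c. a + b + c = 0 \<and> (\<exists>d\<in>hexagon_patch k. hexagon (a, b, c) \<inter> hexagon d \<noteq> {})}"

text \<open>Only meant for \<open>n \<ge> 1\<close>.\<close>

definition circumcoronene :: "nat \<Rightarrow> point pair_pre_digraph" where
  "circumcoronene n = \<lparr>
     pverts = (\<Union>c\<in>hexagon_patch (n - 1). hexagon c),
     parcs = (\<Union>c\<in>hexagon_patch (n - 1). {(u, v). u \<in> hexagon c \<and> v \<in> hexagon c \<and> honeycomb_adj u v}) \<rparr>"


section \<open>Silicate networks\<close>

text \<open>
  \<open>Silicon s\<close> is the original vertex \<open>s\<close>, \<open>Oxygen {s, t}\<close> the vertex subdividing the edge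
  between \<open>s\<close> and \<open>t\<close>, and \<open>Pendant s\<close> the new oxygen vertex attached to \<open>s\<close>.
\<close>

datatype 'a silicate_vertex = Silicon 'a | Oxygen "'a set" | Pendant 'a

definition oxygens :: "'a pair_pre_digraph \<Rightarrow> 'a \<Rightarrow> 'a silicate_vertex set" where
  "oxygens G s =
     {Oxygen {s, t} | t. (s, t) \<in> parcs G} \<union> (if out_degree G s = 2 then {Pendant s} else {})"

definition silicate :: "'a pair_pre_digraph \<Rightarrow> 'a silicate_vertex pair_pre_digraph" where
  "silicate G = \<lparr>
     pverts = Silicon ` pverts G \<union> (\<Union>s\<in>pverts G. oxygens G s),
     parcs = (\<Union>s\<in>pverts G.
        {(Silicon s, p) | p. p \<in> oxygens G s} \<union>
        {(p, Silicon s) | p. p \<in> oxygens G s} \<union>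
        {(p, q). p \<in> oxygens G s \<and> q \<in> oxygens G s \<and> p \<noteq> q}) \<rparr>"

definition silicate_network :: "nat \<Rightarrow> point silicate_vertex pair_pre_digraph" where
  "silicate_network n = silicate (circumcoronene n)"


section \<open>Basic facts\<close>

lemma finite_hexagon: "finite (hexagon c)"
proof (cases c)
  case (fields x y z)
  have "hexagon c \<subseteq> {x..x+1} \<times> {y..y+1} \<times> {z..z+1}"
    by (auto simp: fields)
  then show ?thesis
    by (rule finite_subset) simp
qed

lemma finite_hexagon_patch: "finite (hexagon_patch k)"
proof -
  have near: "\<bar>a - a'\<bar> \<le> 1 \<and> \<bar>b - b'\<bar> \<le> 1 \<and> \<bar>c - c'\<bar> \<le> 1"
    if meet: "hexagon (a, b, c) \<inter> hexagon (a', b', c') \<noteq> {}" for a b c a' b' c'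
  proof -
    have sub: "hexagon (a, b, c) \<subseteq> {a..a+1} \<times> {b..b+1} \<times> {c..c+1}" for a b c
      by auto
    obtain x y z where "(x, y, z) \<in> hexagon (a, b, c)" "(x, y, z) \<in> hexagon (a', b', c')"
      using meet by (metis disjoint_iff prod_cases3)
    then have "x \<in> {a..a+1}" "y \<in> {b..b+1}" "z \<in> {c..c+1}"
        "x \<in> {a'..a'+1}" "y \<in> {b'..b'+1}" "z \<in> {c'..c'+1}"
      using sub by blast+
    then have "\<bar>a - a'\<bar> \<le> 1" "\<bar>b - b'\<bar> \<le> 1" "\<bar>c - c'\<bar> \<le> 1"
      unfolding atLeastAtMost_iff by linarith+
    then show ?thesis by blast
  qed
  have "\<forall>(a, b, c)\<in>hexagon_patch k. \<bar>a\<bar> \<le> int k \<and> \<bar>b\<bar> \<le> int k \<and> \<bar>c\<bar> \<le> int k"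
  proof (induction k)
    case 0
    show ?case by simp
  next
    case (Suc k)
    have "\<bar>a\<bar> \<le> int (Suc k) \<and> \<bar>b\<bar> \<le> int (Suc k) \<and> \<bar>c\<bar> \<le> int (Suc k)"
      if mem: "(a, b, c) \<in> hexagon_patch (Suc k)" for a b c
    proof -
      obtain d where d: "d \<in> hexagon_patch k" "hexagon (a, b, c) \<inter> hexagon d \<noteq> {}"
        using mem unfolding hexagon_patch.simps by blast
      obtain a' b' c' where eq: "d = (a', b', c')" by (rule prod_cases3)
      have 1: "\<bar>a'\<bar> \<le> int k" "\<bar>b'\<bar> \<le> int k" "\<bar>c'\<bar> \<le> int k"
        using Suc d(1) unfolding eq by blast+
      have 2: "\<bar>a - a'\<bar> \<le> 1" "\<bar>b - b'\<bar> \<le> 1" "\<bar>c - c'\<bar> \<le> 1"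
        using near d(2) unfolding eq by blast+
      have "\<bar>a\<bar> \<le> int (Suc k)" using 1(1) 2(1) by simp
      moreover have "\<bar>b\<bar> \<le> int (Suc k)" using 1(2) 2(2) by simp
      moreover have "\<bar>c\<bar> \<le> int (Suc k)" using 1(3) 2(3) by simp
      ultimately show ?thesis by blast
    qed
    then show ?case by blast
  qed
  then have "hexagon_patch k \<subseteq> {- int k..int k} \<times> {- int k..int k} \<times> {- int k..int k}"
    by (fastforce simp: abs_le_iff)
  then show ?thesis
    by (rule finite_subset) simp
qed

lemma pair_graphI:
  assumes "finite (pverts G)" "parcs G \<subseteq> pverts G \<times> pverts G"
    and "sym (parcs G)" "irrefl (parcs G)"
  shows "pair_graph G"
proof -
  have fin: "finite (parcs G)"
    using finite_subset[OF assms(2)] assms(1) by simp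
  show ?thesis
    using assms fin
    by unfold_locales (auto simp: arcs_ends_conv symmetric_def irrefl_def)
qed

lemma honeycomb_adj_sym: "honeycomb_adj u v \<Longrightarrow> honeycomb_adj v u"
  by (cases u; cases v) (auto simp: abs_minus_commute)

lemma honeycomb_adj_irrefl: "\<not> honeycomb_adj u u"
  by (cases u) auto

lemma pair_graph_circumcoronene: "pair_graph (circumcoronene n)"
proof (rule pair_graphI)
  show "finite (pverts (circumcoronene n))"
    by (simp add: circumcoronene_def finite_hexagon finite_hexagon_patch)
  show "parcs (circumcoronene n) \<subseteq> pverts (circumcoronene n) \<times> pverts (circumcoronene n)"
    unfolding circumcoronene_def pair_pre_digraph.simps by blast
  show "sym (parcs (circumcoronene n))"
    unfolding circumcoronene_def pair_pre_digraph.simps sym_def using honeycomb_adj_sym by blast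
  show "irrefl (parcs (circumcoronene n))"
    unfolding circumcoronene_def pair_pre_digraph.simps irrefl_def using honeycomb_adj_irrefl by blast
qed

lemma finite_oxygens:
  assumes "pair_graph G"
  shows "finite (oxygens G s)"
proof -
  interpret pair_graph G by fact
  have "{Oxygen {s, t} | t. (s, t) \<in> parcs G} \<subseteq> (\<lambda>t. Oxygen {s, t}) ` snd ` parcs G"
    by force
  then have "finite {Oxygen {s, t} | t. (s, t) \<in> parcs G}"
    by (rule finite_subset) simp
  then show ?thesis by (simp add: oxygens_def)
qed

lemma pair_graph_silicate:
  assumes "pair_graph G"
  shows "pair_graph (silicate G)"
proof -
  interpret pair_graph G by fact
  have no_sil: "Silicon t \<notin> oxygens G s" for s t
    by (auto simp: oxygens_def)
  show ?thesis
  proof (rule pair_graphI)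
    show "finite (pverts (silicate G))"
      by (simp add: silicate_def finite_oxygens[OF assms])
    show "parcs (silicate G) \<subseteq> pverts (silicate G) \<times> pverts (silicate G)"
      unfolding silicate_def pair_pre_digraph.simps by blast
    show "sym (parcs (silicate G))"
      unfolding silicate_def pair_pre_digraph.simps sym_def by blast
    show "irrefl (parcs (silicate G))"
      unfolding silicate_def pair_pre_digraph.simps irrefl_def using no_sil by fastforce
  qed
qed

lemma pair_graph_silicate_network: "pair_graph (silicate_network n)"
  unfolding silicate_network_def
  by (rule pair_graph_silicate[OF pair_graph_circumcoronene])

end

theory Submission
  imports Defs
begin

text \<open>
  At a vertex of degree 2 in the honeycomb patch, the silicon vertex and its pendant are adjacent
  twins, so both lie in every fault-tolerant resolving set; there are \<open>6n\<close> such pairs.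
  Conversely, up to a shift by one, the distance from a vertex of the network to either twin at \<open>s\<close> is the distance in the honeycomb
  patch from \<open>s\<close> to a vertex or to an edge. The twins together are therefore fault-tolerantly
  resolving as soon as the degree-2 vertices of the patch separate its vertices and edges from each
  other.

  The patch is the set of honeycomb points in the cube \<open>[1 - n, n]\<^sup>3\<close>, and its graph metric is the
  \<open>L\<^sup>1\<close> metric. A vertex or edge is a box with corners \<open>l \<le> h\<close>, and its smallest distance to the side
  \<open>x = n\<close> of the boundary is \<open>2n - 1 + l\<^sub>2 + l\<^sub>3 - h\<^sub>1\<close>. The analogous six minima, one for each side,
  determine the box; three of them are minima for the box reflected by \<open>v \<mapsto> 1 - v\<close>.
\<close>

section \<open>Distances and twins\<close>

text \<open>The Lipschitz condition makes every walk from \<open>u\<close> to \<open>w\<close> at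
  least \<open>h u\<close> long, and following descents builds a walk of exactly that length.
  Distances are computed this way by exhibiting a potential.\<close>

lemma graph_dist_eq_potential:
  fixes h :: "'a \<Rightarrow> nat"
  assumes "pair_wf_digraph G" "u \<in> pverts G" "w \<in> pverts G" "h w = 0"
    and lipschitz: "\<And>u v. (u, v) \<in> parcs G \<Longrightarrow> h u \<le> h v + 1"
    and descent: "\<And>u. u \<in> pverts G \<Longrightarrow> u \<noteq> w \<Longrightarrow> \<exists>v. (u, v) \<in> parcs G \<and> h u = Suc (h v)"
  shows "graph_dist G u w = h u"
proof -
  interpret pair_wf_digraph G by fact
  have cost: "awalk_cost (\<lambda>_. 1) p = length p" for p :: "('a \<times> 'a) list"
    by (induction p) auto
  have lower: "h u \<le> length p" if "awalk u p w" for u p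
    using that
  proof (induction p arbitrary: u)
    case Nil
    then show ?case using assms(4) by (simp add: awalk_Nil_iff)
  next
    case (Cons e p)
    then have "awalk (snd e) p w" "(u, snd e) \<in> parcs G"
      by (auto simp: awalk_Cons_iff)
    then show ?case using Cons.IH[of "snd e"] lipschitz[of u "snd e"] by simp
  qed
  have upper: "\<exists>p. awalk u p w \<and> length p = h u" if "u \<in> pverts G" for u
    using that
  proof (induction "h u" arbitrary: u)
    case 0
    then have "u = w" using descent[of u] by (metis nat.distinct(1))
    then have "awalk u [] w" using assms(3) by (simp add: awalk_Nil_iff)
    then show ?case using 0 by (metis list.size(3))
  next
    case (Suc k)
    then have "u \<noteq> w" using assms(4) by auto
    then obtain v where v: "(u, v) \<in> parcs G" "h u = Suc (h v)"
      using descent Suc.prems by blast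
    then obtain p where "awalk v p w" "length p = h v"
      using Suc.hyps in_arcsD2 by (metis Suc_inject)
    then have "awalk u ((u, v) # p) w \<and> length ((u, v) # p) = h u"
      using v by (simp add: awalk_Cons_iff)
    then show ?case by blast
  qed
  obtain p where p: "awalk u p w" "length p = h u" using upper assms(2) by blast
  have "\<mu> (\<lambda>_. 1) u w \<le> h u"
    using min_cost_le_walk_cost[OF p(1), of "\<lambda>_. 1"] p(2) by (simp add: cost)
  moreover have "h u \<le> \<mu> (\<lambda>_. 1) u w"
    unfolding \<mu>_def by (rule INF_greatest) (auto simp: cost lower)
  ultimately show ?thesis
    unfolding graph_dist_def by (rule antisym)
qed

text \<open>A walk from \<open>y\<close> either goes to \<open>x\<close> first, and then its tail is
  a shorter walk from \<open>x\<close>, or its first arc can be replaced by one starting at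
  \<open>x\<close>. The condition \<open>u \<noteq> y\<close> excludes the empty walk.\<close>

lemma graph_dist_twin_le:
  assumes "pair_wf_digraph G"
    and twin: "\<And>v. (y, v) \<in> parcs G \<Longrightarrow> v \<noteq> x \<Longrightarrow> (x, v) \<in> parcs G"
    and "u \<noteq> y"
  shows "graph_dist G x u \<le> graph_dist G y u"
proof -
  interpret pair_wf_digraph G by fact
  have "\<exists>q. awalk x q u \<and> awalk_cost (\<lambda>_. 1) q \<le> awalk_cost (\<lambda>_. 1) p" if "awalk y p u" for p
  proof (cases p)
    case Nil
    then show ?thesis using that \<open>u \<noteq> y\<close> by (simp add: awalk_Nil_iff)
  next
    case (Cons e q)
    then have walk: "awalk (snd e) q u" and arc: "(y, snd e) \<in> parcs G"
      using that by (auto simp: awalk_Cons_iff)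
    show ?thesis
    proof (cases "snd e = x")
      case True
      then show ?thesis using walk Cons by (intro exI[of _ q]) simp
    next
      case False
      then show ?thesis
        using walk Cons twin[OF arc] by (intro exI[of _ "(x, snd e) # q"]) (simp add: awalk_Cons_iff)
    qed
  qed
  then show ?thesis
    unfolding graph_dist_def \<mu>_def by (intro INF_mono) auto
qed

text \<open>No third vertex tells twins apart, so every resolving set contains one of them. Applied
  to \<open>S - {x}\<close> this forces \<open>y\<close> into \<open>S\<close>, and
  conversely.\<close>

lemma ft_resolving_set_twins:
  assumes "pair_wf_digraph G" "ft_resolving_set G S"
    and "x \<in> pverts G" "y \<in> pverts G" "x \<noteq> y"
    and twins: "\<And>v. v \<noteq> x \<Longrightarrow> v \<noteq> y \<Longrightarrow> (x, v) \<in> parcs G \<longleftrightarrow> (y, v) \<in> parcs G"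
    and loopfree: "(x, x) \<notin> parcs G" "(y, y) \<notin> parcs G"
  shows "x \<in> S" "y \<in> S"
proof -
  have same: "graph_dist G x u = graph_dist G y u" if "u \<noteq> x" "u \<noteq> y" for u
    using twins loopfree that
    by (intro antisym graph_dist_twin_le[OF assms(1)]) metis+
  have hit: "x \<in> R \<or> y \<in> R" if "resolving_set G R" for R
    using that assms(3-5) same unfolding resolving_set_def by metis
  have whole: "resolving_set G S" and minus: "\<And>z. z \<in> S \<Longrightarrow> resolving_set G (S - {z})"
    using assms(2) unfolding ft_resolving_set_def by blast+
  show "x \<in> S" "y \<in> S"
    using hit[OF whole] hit[OF minus, of x] hit[OF minus, of y] by blast+
qed

section \<open>Distances in silicate networks\<close>

text \<open>The network is a union of these complete graphs: adjacency means being distinct members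
  of a common one, which treats all kinds of arcs uniformly.\<close>

definition clique :: "'a pair_pre_digraph \<Rightarrow> 'a \<Rightarrow> 'a silicate_vertex set" where
  "clique G u = insert (Silicon u) (oxygens G u)"

lemma pverts_silicate: "pverts (silicate G) = (\<Union>u\<in>pverts G. clique G u)"
  unfolding silicate_def clique_def by auto

lemma Silicon_notin_oxygens: "Silicon t \<notin> oxygens G s"
  unfolding oxygens_def by auto

lemma parcs_silicate:
  "(a, b) \<in> parcs (silicate G) \<longleftrightarrow> (\<exists>u\<in>pverts G. a \<in> clique G u \<and> b \<in> clique G u \<and> a \<noteq> b)"
  using Silicon_notin_oxygens unfolding silicate_def clique_def by fastforce

lemma Silicon_in_clique_iff: "Silicon s \<in> clique G u \<longleftrightarrow> s = u"
  unfolding clique_def oxygens_def by auto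

lemma Pendant_in_clique_iff: "Pendant s \<in> clique G u \<longleftrightarrow> s = u \<and> out_degree G s = 2"
  unfolding clique_def oxygens_def by auto

lemma Oxygen_in_clique_iff: "Oxygen e \<in> clique G u \<longleftrightarrow> (\<exists>t. e = {u, t} \<and> (u, t) \<in> parcs G)"
  unfolding clique_def oxygens_def by auto

lemmas in_clique_iffs = Silicon_in_clique_iff Pendant_in_clique_iff Oxygen_in_clique_iff

text \<open>The vertex or edge of the original graph that carries a vertex of the network. The twins
  at \<open>u\<close> share a cell.\<close>

primrec cell :: "'a silicate_vertex \<Rightarrow> 'a set" where
  "cell (Silicon u) = {u}"
| "cell (Oxygen e) = e"
| "cell (Pendant u) = {u}"

text \<open>The hypotheses on \<open>D\<close> say that it is the distance to \<open>s\<close> in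
  \<open>G\<close>. One step in the network passes from the oxygen of one edge to that of an
  adjacent edge, so distances are inherited from \<open>G\<close>; the last step inside the clique
  of \<open>s\<close> accounts for \<open>Suc\<close>.\<close>

lemma graph_dist_silicate:
  fixes D :: "'a \<Rightarrow> nat"
  assumes "pair_graph G" "s \<in> pverts G" "out_degree G s = 2" "D s = 0"
    and lipschitz: "\<And>u v. (u, v) \<in> parcs G \<Longrightarrow> D u \<le> D v + 1"
    and descent: "\<And>u. u \<in> pverts G \<Longrightarrow> u \<noteq> s \<Longrightarrow> \<exists>v. (u, v) \<in> parcs G \<and> D u = Suc (D v)"
    and w: "w \<in> {Silicon s, Pendant s}" and a: "a \<in> pverts (silicate G)"
  shows "graph_dist (silicate G) a w = (if a = w then 0 else Suc (Min (D ` cell a)))"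
proof -
  interpret pair_graph G by fact
  interpret sil: pair_graph "silicate G" by (rule pair_graph_silicate) fact
  have symm: "(v, u) \<in> parcs G" if "(u, v) \<in> parcs G" for u v
    using that pair_sym_arcs by (simp add: symmetric_def sym_def)
  \<comment> \<open>The cell of \<open>b\<close> is \<open>u\<close> or an edge at \<open>u\<close>.
    Hence the minima of two members of one clique differ by at most one.\<close>
  have near: "Min (D ` cell b) \<le> D u \<and> D u \<le> Min (D ` cell b) + 1" if "b \<in> clique G u" for b u
    using that lipschitz symm by (cases b) (fastforce simp: in_clique_iffs min_def)+
  have w_clique: "w \<in> clique G u \<longleftrightarrow> u = s" for u
    using w assms(3) by (auto simp: in_clique_iffs)
  \<comment> \<open>An oxygen on an edge lies in the cliques of both ends; the end nearer to
    \<open>s\<close> is taken.\<close>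
  have centre: "\<exists>u\<in>pverts G. b \<in> clique G u \<and> D u = Min (D ` cell b)"
    if mem: "b \<in> pverts (silicate G)" for b
  proof (cases b)
    case (Oxygen e)
    then obtain u t where e: "e = {u, t}" "(u, t) \<in> parcs G"
      using mem unfolding Oxygen pverts_silicate by (auto simp: in_clique_iffs)
    then have "b \<in> clique G u" "b \<in> clique G t"
      using symm unfolding Oxygen Oxygen_in_clique_iff by auto
    moreover have "D u = Min (D ` cell b) \<or> D t = Min (D ` cell b)"
      unfolding Oxygen e by (simp add: min_def)
    ultimately show ?thesis using e(2) in_arcsD1 in_arcsD2 by metis
  qed (use mem in \<open>auto simp: pverts_silicate in_clique_iffs\<close>)
  \<comment> \<open>The value at \<open>w\<close> is separate because the general formula would give
    1 there, which is right for the twin of \<open>w\<close>.\<close>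
  define h where "h b = (if b = w then 0 else Suc (Min (D ` cell b)))" for b
  have "graph_dist (silicate G) a w = h a"
  proof (rule graph_dist_eq_potential)
    show "pair_wf_digraph (silicate G)" by unfold_locales
    show "w \<in> pverts (silicate G)"
      using w_clique assms(2) unfolding pverts_silicate by blast
    show "h w = 0" unfolding h_def by simp
    show "h b \<le> h c + 1" if "(b, c) \<in> parcs (silicate G)" for b c
    proof -
      obtain u where u: "b \<in> clique G u" "c \<in> clique G u"
        using \<open>(b, c) \<in> parcs (silicate G)\<close> unfolding parcs_silicate by blast
      then show ?thesis
        using near[OF u(1)] near[OF u(2)] w_clique[of u] assms(4) unfolding h_def by auto
    qed
    show "\<exists>c. (b, c) \<in> parcs (silicate G) \<and> h b = Suc (h c)"
      if b: "b \<in> pverts (silicate G)" "b \<noteq> w" for b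
    proof -
      obtain u where u: "u \<in> pverts G" "b \<in> clique G u" "D u = Min (D ` cell b)"
        using centre b(1) by blast
      show ?thesis
      proof (cases "u = s")
        case True
        then have "(b, w) \<in> parcs (silicate G)"
          using u b(2) w_clique unfolding parcs_silicate by blast
        then show ?thesis using True u assms(4) b(2) unfolding h_def by auto
      next
        case False
        then obtain v where v: "(u, v) \<in> parcs G" "D u = Suc (D v)"
          using descent u(1) by blast
        \<comment> \<open>The oxygen on the descending edge shares the clique of \<open>u\<close>
          with \<open>b\<close>, and its minimum is attained at \<open>v\<close>.\<close>
        define c where "c = Oxygen {u, v}"
        have c: "c \<in> clique G u" "Min (D ` cell c) = D v" "c \<noteq> w"
          using v w unfolding c_def by (auto simp: in_clique_iffs)
        then have "b \<noteq> c" using u v by auto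
        then have "(b, c) \<in> parcs (silicate G)"
          using u c unfolding parcs_silicate by blast
        moreover have "h b = Suc (D u)" "h c = Suc (D v)"
          using b(2) c u(3) unfolding h_def by simp_all
        ultimately show ?thesis using v(2) by auto
      qed
    qed
  qed (rule a)
  then show ?thesis unfolding h_def by simp
qed

text \<open>Both vertices lie in the clique of \<open>s\<close> and in no other, so they are
  adjacent twins.\<close>

lemma twins_subset_ft_resolving_set:
  assumes "pair_graph G" "ft_resolving_set (silicate G) S" "s \<in> pverts G" "out_degree G s = 2"
  shows "{Silicon s, Pendant s} \<subseteq> S"
proof -
  interpret sil: pair_graph "silicate G" by (rule pair_graph_silicate) fact
  have "pair_wf_digraph (silicate G)" by unfold_locales
  moreover have "Silicon s \<in> pverts (silicate G)" "Pendant s \<in> pverts (silicate G)"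
    using assms unfolding pverts_silicate by (auto simp: in_clique_iffs)
  moreover have "(Silicon s, v) \<in> parcs (silicate G) \<longleftrightarrow> (Pendant s, v) \<in> parcs (silicate G)"
    if "v \<noteq> Silicon s" "v \<noteq> Pendant s" for v
    using that assms(4) unfolding parcs_silicate by (auto simp: in_clique_iffs)
  moreover have "(v, v) \<notin> parcs (silicate G)" for v
    unfolding parcs_silicate by simp
  ultimately show ?thesis
    using ft_resolving_set_twins[OF _ assms(2), of "Silicon s" "Pendant s"] by blast
qed

text \<open>The set \<open>T\<close> of all twins is contained in every fault-tolerant resolving
  set, and it is one itself, hence the minimum.\<close>

lemma ft_metric_dim_silicate:
  fixes G :: "'a pair_pre_digraph" and D :: "'a \<Rightarrow> 'a \<Rightarrow> nat"
  defines "B \<equiv> {s \<in> pverts G. out_degree G s = 2}"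
  assumes "pair_graph G"
    and self: "\<And>s. s \<in> B \<Longrightarrow> D s s = 0"
    and lipschitz: "\<And>s u v. s \<in> B \<Longrightarrow> (u, v) \<in> parcs G \<Longrightarrow> D s u \<le> D s v + 1"
    and descent: "\<And>s u. s \<in> B \<Longrightarrow> u \<in> pverts G \<Longrightarrow> u \<noteq> s \<Longrightarrow>
      \<exists>v. (u, v) \<in> parcs G \<and> D s u = Suc (D s v)"
    and mixed: "\<And>a b. a \<in> pverts (silicate G) \<Longrightarrow> b \<in> pverts (silicate G) \<Longrightarrow>
      cell a \<noteq> cell b \<Longrightarrow> \<exists>s\<in>B. Min (D s ` cell a) \<noteq> Min (D s ` cell b)"
  shows "ft_metric_dim (silicate G) = 2 * card B"
proof -
  interpret pair_graph G by fact
  define T where "T = Silicon ` B \<union> Pendant ` B"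
  have "finite B" unfolding B_def by (simp add: pair_finite_verts)
  then have "finite T" unfolding T_def by simp
  have "card T = card (Silicon ` B) + card (Pendant ` B)"
    unfolding T_def using \<open>finite B\<close> by (intro card_Un_disjoint) auto
  then have card_T: "card T = 2 * card B"
    by (simp add: card_image inj_on_def)
  have dist: "graph_dist (silicate G) a w = (if a = w then 0 else Suc (Min (D s ` cell a)))"
    if "s \<in> B" "w \<in> {Silicon s, Pendant s}" "a \<in> pverts (silicate G)" for s w a
  proof -
    have s: "s \<in> pverts G" "out_degree G s = 2" using that(1) unfolding B_def by auto
    show ?thesis
      by (rule graph_dist_silicate[OF assms(2) s self[OF that(1)] lipschitz[OF that(1)]
            descent[OF that(1)] that(2,3)])
  qed
  \<comment> \<open>Stated for any \<open>R\<close> meeting each pair, to cover \<open>T\<close> and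
    all \<open>T - {x}\<close> at once.\<close>
  have resolving: "resolving_set (silicate G) R"
    if R: "R \<subseteq> T" "\<And>s. s \<in> B \<Longrightarrow> Silicon s \<in> R \<or> Pendant s \<in> R" for R
    unfolding resolving_set_def
  proof (intro conjI ballI impI)
    show "R \<subseteq> pverts (silicate G)"
      using R(1) unfolding T_def B_def pverts_silicate by (auto simp: in_clique_iffs)
    fix a b assume ab: "a \<in> pverts (silicate G)" "b \<in> pverts (silicate G)" "a \<noteq> b"
    have "\<exists>s\<in>B. Min (D s ` cell a) \<noteq> Min (D s ` cell b) \<or> {a, b} = {Silicon s, Pendant s}"
    proof (cases "cell a = cell b")
      \<comment> \<open>An oxygen on an edge has a two-element cell that determines it, so two
        distinct vertices with the same cell are twins.\<close>
      case True
      have "card (cell c) = 2" if "Oxygen e = c" "c \<in> pverts (silicate G)" for c e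
        using that pair_no_loops unfolding pverts_silicate
        by (auto simp: in_clique_iffs card_insert_if)
      then have "\<exists>s. {a, b} = {Silicon s, Pendant s}"
        using ab True by (cases a; cases b) force+
      then show ?thesis
        using ab unfolding B_def pverts_silicate by (fastforce simp: in_clique_iffs doubleton_eq_iff)
    next
      case False
      then show ?thesis using mixed ab by blast
    qed
    then obtain s where s: "s \<in> B"
        "Min (D s ` cell a) \<noteq> Min (D s ` cell b) \<or> {a, b} = {Silicon s, Pendant s}"
      by blast
    obtain w where w: "w \<in> R" "w \<in> {Silicon s, Pendant s}" using R(2) s(1) by blast
    have "graph_dist (silicate G) a w \<noteq> graph_dist (silicate G) b w"
      using s(2) w(2) ab(3) unfolding dist[OF s(1) w(2) ab(1)] dist[OF s(1) w(2) ab(2)]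
      by (auto simp: doubleton_eq_iff)
    then show "\<exists>w\<in>R. graph_dist (silicate G) a w \<noteq> graph_dist (silicate G) b w"
      using w(1) by blast
  qed
  have "ft_resolving_set (silicate G) T"
    unfolding ft_resolving_set_def by (intro conjI ballI resolving) (auto simp: T_def)
  moreover have "card T \<le> card S" if "finite S" "ft_resolving_set (silicate G) S" for S
  proof -
    have "T \<subseteq> S"
      using twins_subset_ft_resolving_set[OF assms(2) that(2)] unfolding T_def B_def by blast
    then show ?thesis using \<open>finite S\<close> by (rule card_mono[rotated])
  qed
  ultimately have "ft_metric_dim (silicate G) = card T"
    unfolding ft_metric_dim_def using \<open>finite T\<close> by (intro Least_equality) blast+
  then show ?thesis using card_T by simp
qed

section \<open>Coordinates for circumcoronenes\<close>

lemma in_hexagon_iff: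
  "(x, y, z) \<in> hexagon (a, b, c) \<longleftrightarrow>
     x - a \<in> {0..1} \<and> y - b \<in> {0..1} \<and> z - c \<in> {0..1} \<and> x + y + z - (a + b + c) \<in> {1..2}"
  (is "?L \<longleftrightarrow> ?R")
proof
  have bit: "i \<in> {0, 1} \<longleftrightarrow> i \<in> {0..1}" and sum_bits: "i \<in> {1, 2} \<longleftrightarrow> i \<in> {1..2}" for i :: int
    by auto
  assume ?R
  then have "x = a + (x - a) \<and> y = b + (y - b) \<and> z = c + (z - c) \<and>
      x - a \<in> {0, 1} \<and> y - b \<in> {0, 1} \<and> z - c \<in> {0, 1} \<and> (x - a) + (y - b) + (z - c) \<in> {1, 2}"
    unfolding bit sum_bits by (simp add: algebra_simps)
  then show ?L unfolding hexagon.simps by blast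
qed auto

text \<open>Faces that meet have centres differing by at most one in each coordinate; conversely,
  each face of the larger hexagon meets one of the smaller.\<close>

lemma hexagon_patch_eq:
  "hexagon_patch k = {(a, b, c). a + b + c = 0 \<and> \<bar>a\<bar> \<le> int k \<and> \<bar>b\<bar> \<le> int k \<and> \<bar>c\<bar> \<le> int k}"
proof (induction k)
  case 0
  then show ?case by auto
next
  case (Suc k)
  have "(a, b, c) \<in> hexagon_patch (Suc k) \<longleftrightarrow>
      a + b + c = 0 \<and> \<bar>a\<bar> \<le> int (Suc k) \<and> \<bar>b\<bar> \<le> int (Suc k) \<and> \<bar>c\<bar> \<le> int (Suc k)"
    (is "?L \<longleftrightarrow> ?R") for a b c
  proof
    assume ?L
    then obtain d p where sum: "a + b + c = 0" and d: "d \<in> hexagon_patch k"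
        and p: "p \<in> hexagon (a, b, c)" "p \<in> hexagon d"
      unfolding hexagon_patch.simps by blast
    obtain a' b' c' where d_eq: "d = (a', b', c')" by (rule prod_cases3)
    obtain x y z where p_eq: "p = (x, y, z)" by (rule prod_cases3)
    have "\<bar>a'\<bar> \<le> int k" "\<bar>b'\<bar> \<le> int k" "\<bar>c'\<bar> \<le> int k"
      using d unfolding d_eq Suc by auto
    moreover have "\<bar>a - a'\<bar> \<le> 1" "\<bar>b - b'\<bar> \<le> 1" "\<bar>c - c'\<bar> \<le> 1"
      using p unfolding d_eq p_eq in_hexagon_iff by auto
    ultimately show ?R using sum by auto
  next
    assume R: ?R
    have step: ?L if "(a', b', c') \<in> hexagon_patch k"
        "(x, y, z) \<in> hexagon (a, b, c)" "(x, y, z) \<in> hexagon (a', b', c')" for a' b' c' x y z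
      using R that unfolding hexagon_patch.simps by blast
    let ?in = "\<lambda>a b c. \<bar>a\<bar> \<le> int k \<and> \<bar>b\<bar> \<le> int k \<and> \<bar>c\<bar> \<le> int k"
    \<comment> \<open>The face itself or one of its six neighbours: if the face is outside the
      smaller hexagon, lowering its largest coordinate and raising its smallest by one moves it
      inside.\<close>
    have "?in a b c \<or> ?in (a - 1) (b + 1) c \<or> ?in (a - 1) b (c + 1) \<or> ?in (a + 1) (b - 1) c \<or>
        ?in a (b - 1) (c + 1) \<or> ?in (a + 1) b (c - 1) \<or> ?in a (b + 1) (c - 1)"
      using R by (smt (verit) of_nat_Suc of_nat_0_le_iff)
    then show ?L
    proof (elim disjE, goal_cases)
      case 1
      with R show ?case by (intro step[of a b c "a + 1" b c]) (simp_all add: Suc in_hexagon_iff)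
    next
      case 2
      with R show ?case by (intro step[of "a - 1" "b + 1" c a "b + 1" c]) (simp_all add: Suc in_hexagon_iff)
    next
      case 3
      with R show ?case by (intro step[of "a - 1" b "c + 1" a b "c + 1"]) (simp_all add: Suc in_hexagon_iff)
    next
      case 4
      with R show ?case by (intro step[of "a + 1" "b - 1" c "a + 1" b c]) (simp_all add: Suc in_hexagon_iff)
    next
      case 5
      with R show ?case by (intro step[of a "b - 1" "c + 1" a b "c + 1"]) (simp_all add: Suc in_hexagon_iff)
    next
      case 6
      with R show ?case by (intro step[of "a + 1" b "c - 1" "a + 1" b c]) (simp_all add: Suc in_hexagon_iff)
    next
      case 7
      with R show ?case by (intro step[of a "b + 1" "c - 1" a "b + 1" c]) (simp_all add: Suc in_hexagon_iff)
    qed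
  qed
  then show ?case by (simp del: hexagon_patch.simps add: set_eq_iff)
qed

lemma pverts_circumcoronene:
  assumes "n \<ge> 1"
  shows "pverts (circumcoronene n) = {(x, y, z). x + y + z \<in> {1..2} \<and>
    x \<in> {1 - int n..int n} \<and> y \<in> {1 - int n..int n} \<and> z \<in> {1 - int n..int n}}"
proof -
  have "(x, y, z) \<in> pverts (circumcoronene n) \<longleftrightarrow> x + y + z \<in> {1..2} \<and>
    x \<in> {1 - int n..int n} \<and> y \<in> {1 - int n..int n} \<and> z \<in> {1 - int n..int n}"
    (is "_ \<longleftrightarrow> ?R") for x y z
  proof
    assume "(x, y, z) \<in> pverts (circumcoronene n)"
    then obtain a b c where "(a, b, c) \<in> hexagon_patch (n - 1)" "(x, y, z) \<in> hexagon (a, b, c)"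
      unfolding circumcoronene_def by auto
    then show ?R
      using assms unfolding hexagon_patch_eq in_hexagon_iff by (auto simp: of_nat_diff)
  next
    assume R: ?R
    let ?in = "\<lambda>a b c. (a, b, c) \<in> hexagon_patch (n - 1) \<and> (x, y, z) \<in> hexagon (a, b, c)"
    \<comment> \<open>Centres have sum 0, so one coordinate is lowered when the vertex has sum 1,
      and two when it has sum 2.\<close>
    have "?in (x - 1) y z \<or> ?in x (y - 1) z \<or> ?in x y (z - 1) \<or>
        ?in (x - 1) (y - 1) z \<or> ?in (x - 1) y (z - 1) \<or> ?in x (y - 1) (z - 1)"
      using R assms unfolding hexagon_patch_eq in_hexagon_iff
      by (simp add: of_nat_diff) (smt (z3))
    then show "(x, y, z) \<in> pverts (circumcoronene n)"
      unfolding circumcoronene_def pair_pre_digraph.simps by blast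
  qed
  then show ?thesis by auto
qed

text \<open>The patch is an induced subgraph: adjacent vertices of the patch always share one of its
  faces.\<close>

lemma parcs_circumcoronene:
  assumes "n \<ge> 1"
  shows "(u, v) \<in> parcs (circumcoronene n) \<longleftrightarrow>
    u \<in> pverts (circumcoronene n) \<and> v \<in> pverts (circumcoronene n) \<and> honeycomb_adj u v"
proof
  show "u \<in> pverts (circumcoronene n) \<and> v \<in> pverts (circumcoronene n) \<and> honeycomb_adj u v"
    if "(u, v) \<in> parcs (circumcoronene n)"
    using that unfolding circumcoronene_def by auto
next
  assume R: "u \<in> pverts (circumcoronene n) \<and> v \<in> pverts (circumcoronene n) \<and> honeycomb_adj u v"
  obtain x y z x' y' z' where uv: "u = (x, y, z)" "v = (x', y', z')"
    by (metis prod_cases3)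
  \<comment> \<open>The ends have sums 1 and 2, so this is the end with sum 1; lowering one
    coordinate gives the candidate centres.\<close>
  define a b c where "a = min x x'" "b = min y y'" "c = min z z'"
  let ?in = "\<lambda>a b c. (a, b, c) \<in> hexagon_patch (n - 1) \<and> u \<in> hexagon (a, b, c) \<and> v \<in> hexagon (a, b, c)"
  have "?in (a - 1) b c \<or> ?in a (b - 1) c \<or> ?in a b (c - 1)"
    using R assms unfolding uv pverts_circumcoronene[OF assms] hexagon_patch_eq in_hexagon_iff a_b_c_def
    by (simp add: of_nat_diff) (smt (z3))
  then show "(u, v) \<in> parcs (circumcoronene n)"
    using R unfolding circumcoronene_def pair_pre_digraph.simps by blast
qed

section \<open>The graph metric of the patch\<close>

fun l1_dist :: "point \<Rightarrow> point \<Rightarrow> nat" where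
  "l1_dist (x, y, z) (x', y', z') = nat (\<bar>x - x'\<bar> + \<bar>y - y'\<bar> + \<bar>z - z'\<bar>)"

lemma l1_dist_lipschitz:
  assumes "honeycomb_adj u v"
  shows "l1_dist s u \<le> l1_dist s v + 1"
proof -
  obtain a b c x y z x' y' z' where eq: "s = (a, b, c)" "u = (x, y, z)" "v = (x', y', z')"
    by (metis prod_cases3)
  have "\<bar>a - x\<bar> \<le> \<bar>a - x'\<bar> + \<bar>x - x'\<bar>" "\<bar>b - y\<bar> \<le> \<bar>b - y'\<bar> + \<bar>y - y'\<bar>"
      "\<bar>c - z\<bar> \<le> \<bar>c - z'\<bar> + \<bar>z - z'\<bar>"
    by linarith+
  then have "\<bar>a - x\<bar> + \<bar>b - y\<bar> + \<bar>c - z\<bar> \<le> (\<bar>a - x'\<bar> + \<bar>b - y'\<bar> + \<bar>c - z'\<bar>) + 1"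
    using assms unfolding eq honeycomb_adj.simps by linarith
  then have "nat (\<bar>a - x\<bar> + \<bar>b - y\<bar> + \<bar>c - z\<bar>) \<le> nat ((\<bar>a - x'\<bar> + \<bar>b - y'\<bar> + \<bar>c - z'\<bar>) + 1)"
    by (rule nat_mono)
  then show ?thesis unfolding eq l1_dist.simps by (simp add: nat_add_distrib)
qed

text \<open>If \<open>u\<close> has sum 1, then some coordinate of \<open>u\<close> is below that of
  \<open>s\<close>; raising it stays inside the cube because \<open>s\<close> lies there. Sum 2 is
  symmetric, with a coordinate lowered.\<close>

lemma l1_dist_descent:
  assumes "n \<ge> 1" "s \<in> pverts (circumcoronene n)" "u \<in> pverts (circumcoronene n)" "u \<noteq> s"
  shows "\<exists>v. (u, v) \<in> parcs (circumcoronene n) \<and> l1_dist s u = Suc (l1_dist s v)"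
proof -
  obtain a b c x y z where su: "s = (a, b, c)" "u = (x, y, z)"
    by (metis prod_cases3)
  let ?good = "\<lambda>v. v \<in> pverts (circumcoronene n) \<and> honeycomb_adj u v \<and> l1_dist s u = Suc (l1_dist s v)"
  have good: ?thesis if "?good v" for v
    using that assms(3) parcs_circumcoronene[OF assms(1)] by blast
  have box: "x + y + z \<in> {1..2}" "a + b + c \<in> {1..2}"
      "x \<in> {1 - int n..int n}" "y \<in> {1 - int n..int n}" "z \<in> {1 - int n..int n}"
      "a \<in> {1 - int n..int n}" "b \<in> {1 - int n..int n}" "c \<in> {1 - int n..int n}"
    using assms unfolding su pverts_circumcoronene[OF assms(1)] by auto
  show ?thesis
  proof (cases "x + y + z = 1")
    case True
    then have "x < a \<or> y < b \<or> z < c"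
      using box(2) assms(4) unfolding su by auto
    then show ?thesis
    proof (elim disjE)
      assume "x < a"
      then show ?thesis
        using box True by (intro good[of "(x + 1, y, z)"]) (auto simp: su pverts_circumcoronene[OF assms(1)])
    next
      assume "y < b"
      then show ?thesis
        using box True by (intro good[of "(x, y + 1, z)"]) (auto simp: su pverts_circumcoronene[OF assms(1)])
    next
      assume "z < c"
      then show ?thesis
        using box True by (intro good[of "(x, y, z + 1)"]) (auto simp: su pverts_circumcoronene[OF assms(1)])
    qed
  next
    case False
    then have "x > a \<or> y > b \<or> z > c"
      using box(1,2) assms(4) unfolding su by auto
    then show ?thesis
    proof (elim disjE)
      assume "x > a"
      then show ?thesis
        using box False by (intro good[of "(x - 1, y, z)"]) (auto simp: su pverts_circumcoronene[OF assms(1)])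
    next
      assume "y > b"
      then show ?thesis
        using box False by (intro good[of "(x, y - 1, z)"]) (auto simp: su pverts_circumcoronene[OF assms(1)])
    next
      assume "z > c"
      then show ?thesis
        using box False by (intro good[of "(x, y, z - 1)"]) (auto simp: su pverts_circumcoronene[OF assms(1)])
    qed
  qed
qed

section \<open>The vertices of degree 2\<close>

fun on_boundary :: "int \<Rightarrow> point \<Rightarrow> bool" where
  "on_boundary N (x, y, z) \<longleftrightarrow>
     (x + y + z = 1 \<and> N \<in> {x, y, z}) \<or> (x + y + z = 2 \<and> 1 - N \<in> {x, y, z})"

lemma card_Int_three:
  assumes "distinct [a, b, c]"
  shows "card (V \<inter> {a, b, c}) = of_bool (a \<in> V) + of_bool (b \<in> V) + of_bool (c \<in> V)"
  using assms by (auto simp: Int_insert_right)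

lemma abs_diff_up:
  fixes x y z x' y' z' :: int
  assumes "x + y + z = 1" "x' + y' + z' \<in> {1..2}"
  shows "\<bar>x - x'\<bar> + \<bar>y - y'\<bar> + \<bar>z - z'\<bar> = 1 \<longleftrightarrow>
    (x' = x + 1 \<and> y' = y \<and> z' = z) \<or> (x' = x \<and> y' = y + 1 \<and> z' = z) \<or> (x' = x \<and> y' = y \<and> z' = z + 1)"
  using assms unfolding atLeastAtMost_iff by (smt (verit))

text \<open>Reflecting every coordinate \<open>a\<close> to \<open>1 - a\<close> exchanges the sums
  1 and 2 and reduces this to \<open>abs_diff_up\<close>.\<close>

lemma abs_diff_down:
  fixes x y z x' y' z' :: int
  assumes "x + y + z = 2" "x' + y' + z' \<in> {1..2}"
  shows "\<bar>x - x'\<bar> + \<bar>y - y'\<bar> + \<bar>z - z'\<bar> = 1 \<longleftrightarrow>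
    (x' = x - 1 \<and> y' = y \<and> z' = z) \<or> (x' = x \<and> y' = y - 1 \<and> z' = z) \<or> (x' = x \<and> y' = y \<and> z' = z - 1)"
proof -
  have flipped: "1 - x + (1 - y) + (1 - z) = 1" "1 - x' + (1 - y') + (1 - z') \<in> {1..2}"
    using assms by auto
  have flip: "\<bar>(1 - a) - (1 - b)\<bar> = \<bar>a - b\<bar>" "1 - b = 1 - a + 1 \<longleftrightarrow> b = a - 1" "1 - b = 1 - a \<longleftrightarrow> b = a"
    for a b :: int
    by linarith+
  show ?thesis
    using abs_diff_up[OF flipped] unfolding flip .
qed

text \<open>A vertex of sum 1 has its neighbours one step up, and loses one for each coordinate
  equal to \<open>n\<close>. Two such coordinates would force the third below \<open>1 - n\<close>,
  so at most one neighbour is lost. Sum 2 is the mirror image.\<close>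

lemma out_degree_circumcoronene:
  assumes "n \<ge> 1" "u \<in> pverts (circumcoronene n)"
  shows "out_degree (circumcoronene n) u = 2 \<longleftrightarrow> on_boundary (int n) u"
proof -
  obtain x y z where u: "u = (x, y, z)" by (rule prod_cases3)
  have box: "x + y + z \<in> {1..2}"
      "x \<in> {1 - int n..int n}" "y \<in> {1 - int n..int n}" "z \<in> {1 - int n..int n}"
    using assms unfolding u pverts_circumcoronene[OF assms(1)] by auto
  have "out_arcs (circumcoronene n) u = Pair u ` {v. (u, v) \<in> parcs (circumcoronene n)}"
    unfolding out_arcs_def by auto
  then have deg: "out_degree (circumcoronene n) u = card {v. (u, v) \<in> parcs (circumcoronene n)}"
    unfolding out_degree_def by (simp add: card_image inj_on_def)
  have V_sum: "x' + y' + z' \<in> {1..2}" if "(x', y', z') \<in> pverts (circumcoronene n)" for x' y' z'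
    using that unfolding pverts_circumcoronene[OF assms(1)] by simp
  show ?thesis
  proof (cases "x + y + z = 1")
    case True
    have "{v. (u, v) \<in> parcs (circumcoronene n)} =
        pverts (circumcoronene n) \<inter> {(x + 1, y, z), (x, y + 1, z), (x, y, z + 1)}"
      using assms(2) abs_diff_up[OF True V_sum] unfolding parcs_circumcoronene[OF assms(1)] u
      by (simp add: set_eq_iff) blast
    then have "out_degree (circumcoronene n) u = of_bool (x < int n) + of_bool (y < int n) + of_bool (z < int n)"
      using True box unfolding deg
      by (simp add: card_Int_three pverts_circumcoronene[OF assms(1)])
    then show ?thesis
      using True box by (auto simp: u)
  next
    case False
    then have sum: "x + y + z = 2" using box(1) by simp
    have "{v. (u, v) \<in> parcs (circumcoronene n)} =
        pverts (circumcoronene n) \<inter> {(x - 1, y, z), (x, y - 1, z), (x, y, z - 1)}"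
      using assms(2) abs_diff_down[OF sum V_sum] unfolding parcs_circumcoronene[OF assms(1)] u
      by (simp add: set_eq_iff) blast
    then have "out_degree (circumcoronene n) u =
        of_bool (x > 1 - int n) + of_bool (y > 1 - int n) + of_bool (z > 1 - int n)"
      using sum box unfolding deg
      by (simp add: card_Int_three pverts_circumcoronene[OF assms(1)])
    then show ?thesis
      using sum box by (auto simp: u)
  qed
qed

lemma card_boundary:
  assumes "n \<ge> 1"
  shows "card {s \<in> pverts (circumcoronene n). on_boundary (int n) s} = 6 * n"
proof -
  let ?N = "int n"
  define I where "I = {1 - ?N..0}"
  \<comment> \<open>The three sides with sum 1, each with \<open>n\<close> points;
    \<open>flip\<close> maps them to the three sides with sum 2.\<close>
  define P where "P = (\<lambda>t. (?N, t, 1 - ?N - t)) ` I \<union> (\<lambda>t. (1 - ?N - t, ?N, t)) ` I \<union>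
    (\<lambda>t. (t, 1 - ?N - t, ?N)) ` I"
  define flip :: "point \<Rightarrow> point" where "flip = (\<lambda>(x, y, z). (1 - x, 1 - y, 1 - z))"
  have flip_mem: "p \<in> flip ` P \<longleftrightarrow> flip p \<in> P" for p
  proof -
    have "flip (flip q) = q" for q unfolding flip_def by (cases q) auto
    then show ?thesis by (metis imageE imageI)
  qed
  have "finite I" "card I = n" unfolding I_def by auto
  then have "finite P" unfolding P_def by simp
  have P_eq: "P = {(x, y, z). x + y + z = 1 \<and> ?N \<in> {x, y, z} \<and>
      x \<in> {1 - ?N..?N} \<and> y \<in> {1 - ?N..?N} \<and> z \<in> {1 - ?N..?N}}"
    unfolding P_def I_def by (auto simp: image_iff)
  have "card P = 3 * n"
    unfolding P_def using \<open>finite I\<close> \<open>card I = n\<close> assms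
    by (subst card_Un_disjoint; (subst card_Un_disjoint)?)
      (auto simp: card_image inj_on_def I_def)
  moreover have "inj flip" unfolding flip_def by (auto simp: inj_def)
  ultimately have "card (flip ` P) = 3 * n"
    by (simp add: card_image inj_on_subset[OF \<open>inj flip\<close>])
  moreover have "P \<inter> flip ` P = {}"
  proof -
    have False if "p \<in> P" "flip p \<in> P" for p
    proof -
      obtain x y z where p: "p = (x, y, z)" by (rule prod_cases3)
      have "x + y + z = 1" "(1 - x) + (1 - y) + (1 - z) = 1"
        using that unfolding P_eq flip_def p by simp_all
      then show False by linarith
    qed
    then show ?thesis unfolding disjoint_iff flip_mem by blast
  qed
  ultimately have "card (P \<union> flip ` P) = 6 * n"
    using \<open>card P = 3 * n\<close> \<open>finite P\<close> by (simp add: card_Un_disjoint)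
  moreover have "{s \<in> pverts (circumcoronene n). on_boundary ?N s} = P \<union> flip ` P"
  proof (rule set_eqI)
    fix s :: point
    obtain x y z where s: "s = (x, y, z)" by (rule prod_cases3)
    have flip_sum: "1 - x + (1 - y) + (1 - z) = 1 \<longleftrightarrow> x + y + z = 2" by linarith
    have flip_coord: "?N = 1 - a \<longleftrightarrow> 1 - ?N = a" "1 - a \<in> {1 - ?N..?N} \<longleftrightarrow> a \<in> {1 - ?N..?N}" for a
      by auto
    have "x + y + z \<in> {1..2} \<longleftrightarrow> x + y + z = 1 \<or> x + y + z = 2" by auto
    then show "s \<in> {s \<in> pverts (circumcoronene n). on_boundary ?N s} \<longleftrightarrow> s \<in> P \<union> flip ` P"
      unfolding Un_iff flip_mem
      unfolding s flip_def P_eq pverts_circumcoronene[OF assms] mem_Collect_eq prod.case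
        on_boundary.simps insert_iff empty_iff flip_sum flip_coord by blast
  qed
  ultimately show ?thesis by simp
qed

section \<open>Separating vertices and edges\<close>

text \<open>For \<open>l \<le> h\<close>, the distance from \<open>s\<close> to the interval from
  \<open>l\<close> to \<open>h\<close>.\<close>

definition gap :: "int \<Rightarrow> int \<Rightarrow> int \<Rightarrow> int" where
  "gap s l h = max 0 (max (l - s) (s - h))"

text \<open>
  Along a side of the boundary, the distance to a box is smallest at the points that lie below the
  lower corner of the box in the two free coordinates.
\<close>

lemma side_determines:
  fixes N :: int
  assumes eq: "\<And>t. t \<in> {1 - N..0} \<Longrightarrow>
      gap N l1 h1 + gap t l2 h2 + gap (1 - N - t) l3 h3 = gap N l1' h1' + gap t l2' h2' + gap (1 - N - t) l3' h3'"
    and "l1 \<le> h1" "l2 \<le> h2" "l3 \<le> h3" "h1 \<le> N" "1 - N \<le> l2" "1 - N \<le> l3" "1 \<le> l1 + l2 + l3"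
    and "l1' \<le> h1'" "l2' \<le> h2'" "l3' \<le> h3'" "h1' \<le> N" "1 - N \<le> l2'" "1 - N \<le> l3'" "1 \<le> l1' + l2' + l3'"
    and "1 \<le> N"
  shows "l2 + l3 - h1 = l2' + l3' - h1'"
proof -
  have lower: "2 * N - 1 + l2 + l3 - h1 \<le> gap N l1 h1 + gap t l2 h2 + gap (1 - N - t) l3 h3"
    for t l1 l2 l3 h1 h2 h3
    unfolding gap_def by linarith
  \<comment> \<open>The witness is the least \<open>t\<close> in range with
    \<open>1 - N - t \<le> l3\<close>; it satisfies \<open>t \<le> l2\<close> because
    \<open>l1 \<le> N\<close> gives \<open>l2 + l3 \<ge> 1 - N\<close>.\<close>
  have attained: "\<exists>t\<in>{1 - N..0}. gap N l1 h1 + gap t l2 h2 + gap (1 - N - t) l3 h3 = 2 * N - 1 + l2 + l3 - h1"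
    if "l1 \<le> h1" "l2 \<le> h2" "l3 \<le> h3" "h1 \<le> N" "1 - N \<le> l2" "1 - N \<le> l3" "1 \<le> l1 + l2 + l3"
    for l1 l2 l3 h1 h2 h3
    using that \<open>1 \<le> N\<close> unfolding gap_def by (intro bexI[of _ "max (1 - N) (1 - N - l3)"]) auto
  obtain t where "t \<in> {1 - N..0}"
      "gap N l1 h1 + gap t l2 h2 + gap (1 - N - t) l3 h3 = 2 * N - 1 + l2 + l3 - h1"
    using attained[OF assms(2-8)] by blast
  moreover obtain t' where "t' \<in> {1 - N..0}"
      "gap N l1' h1' + gap t' l2' h2' + gap (1 - N - t') l3' h3' = 2 * N - 1 + l2' + l3' - h1'"
    using attained[OF assms(9-15)] by blast
  ultimately show ?thesis
    using eq[of t] eq[of t'] lower[of l2' l3' h1' l1' t h2' h3'] lower[of l2 l3 h1 l1 t' h2 h3]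
    by linarith
qed

lemma gap_flip: "gap (1 - s) (1 - h) (1 - l) = gap s l h"
  unfolding gap_def by linarith

text \<open>Either the box is a point, and each expression is the coordinate sum minus twice a
  coordinate, or the corners have sums 1 and 2. Adding up the equations shows that both boxes are of
  the same kind. In the second case the equations give each \<open>l + h\<close>, and its parity
  tells \<open>l\<close> from \<open>h\<close> since the sides have length at most one.\<close>

lemma box_eqI:
  fixes l1 l2 l3 h1 h2 h3 :: int
  assumes "l1 \<le> h1" "l2 \<le> h2" "l3 \<le> h3" "1 \<le> l1 + l2 + l3" "h1 + h2 + h3 \<le> 2"
    and "l1' \<le> h1'" "l2' \<le> h2'" "l3' \<le> h3'" "1 \<le> l1' + l2' + l3'" "h1' + h2' + h3' \<le> 2"
    and "l2 + l3 - h1 = l2' + l3' - h1'" "l3 + l1 - h2 = l3' + l1' - h2'" "l1 + l2 - h3 = l1' + l2' - h3'"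
    and "h2 + h3 - l1 = h2' + h3' - l1'" "h3 + h1 - l2 = h3' + h1' - l2'" "h1 + h2 - l3 = h1' + h2' - l3'"
  shows "l1 = l1' \<and> l2 = l2' \<and> l3 = l3' \<and> h1 = h1' \<and> h2 = h2' \<and> h3 = h3'"
proof (cases "l1 + l2 + l3 = h1 + h2 + h3")
  case True
  then have "h1 = l1" "h2 = l2" "h3 = l3" "h1' = l1'" "h2' = l2'" "h3' = l3'"
    using assms by linarith+
  then show ?thesis using assms(11-13) by linarith
next
  case False
  have midpoint: "l = l' \<and> h = h'"
    if "l \<le> h" "h \<le> l + 1" "l' \<le> h'" "h' \<le> l' + 1" "l + h = l' + h'" for l h l' h' :: int
    using that by presburger
  have "l1 + h1 = l1' + h1'" "l2 + h2 = l2' + h2'" "l3 + h3 = l3' + h3'"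
    using assms False by linarith+
  moreover have "h1 \<le> l1 + 1" "h2 \<le> l2 + 1" "h3 \<le> l3 + 1" "h1' \<le> l1' + 1" "h2' \<le> l2' + 1" "h3' \<le> l3' + 1"
    using assms by linarith+
  ultimately show ?thesis
    using midpoint[of l1 h1 l1' h1'] midpoint[of l2 h2 l2' h2'] midpoint[of l3 h3 l3' h3'] assms(1-3,6-8)
    by blast
qed

section \<open>Vertices and edges as boxes\<close>

fun box_dist :: "point \<Rightarrow> point \<Rightarrow> point \<Rightarrow> int" where
  "box_dist (x, y, z) (l1, l2, l3) (h1, h2, h3) = gap x l1 h1 + gap y l2 h2 + gap z l3 h3"

text \<open>Edges are oriented from sum 1 to sum 2, which makes \<open>l\<close> the lower corner in
  every coordinate.\<close>

definition honeycomb_cell :: "point \<Rightarrow> point \<Rightarrow> bool" where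
  "honeycomb_cell l h \<longleftrightarrow> l = h \<or> (honeycomb_adj l h \<and> (\<exists>x y z. l = (x, y, z) \<and> x + y + z = 1) \<and>
     (\<exists>x y z. h = (x, y, z) \<and> x + y + z = 2))"

text \<open>The two ends differ in at most one coordinate, so the minimum moves into that
  coordinate, where it becomes the distance to an interval of length at most one.\<close>

lemma Min_l1_dist_cell:
  assumes "honeycomb_cell l h"
  shows "int (Min (l1_dist s ` {l, h})) = box_dist s l h"
proof -
  obtain x y z l1 l2 l3 h1 h2 h3 where eq: "s = (x, y, z)" "l = (l1, l2, l3)" "h = (h1, h2, h3)"
    by (metis prod_cases3)
  have "h = l \<or> h = (l1 + 1, l2, l3) \<or> h = (l1, l2 + 1, l3) \<or> h = (l1, l2, l3 + 1)"
  proof (cases "l = h")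
    case False
    then have "l1 + l2 + l3 = 1" "h1 + h2 + h3 \<in> {1..2}" "\<bar>l1 - h1\<bar> + \<bar>l2 - h2\<bar> + \<bar>l3 - h3\<bar> = 1"
      using assms unfolding honeycomb_cell_def eq by auto
    then show ?thesis
      using abs_diff_up[of l1 l2 l3 h1 h2 h3] unfolding eq by simp
  qed simp
  then have cases: "(h1, h2, h3) \<in> {(l1, l2, l3), (l1 + 1, l2, l3), (l1, l2 + 1, l3), (l1, l2, l3 + 1)}"
    unfolding eq by simp
  have Min: "int (Min (l1_dist s ` {l, h})) = min (int (l1_dist s l)) (int (l1_dist s h))"
    by (simp add: min_def)
  have l1: "int (l1_dist (a, b, c) (a', b', c')) = \<bar>a - a'\<bar> + \<bar>b - b'\<bar> + \<bar>c - c'\<bar>" for a b c a' b' c'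
    by simp
  have gaps: "gap a b b = \<bar>a - b\<bar>" "gap a b (b + 1) = min \<bar>a - b\<bar> \<bar>a - (b + 1)\<bar>" for a b
    unfolding gap_def by linarith+
  have min_add: "min (a + c) (b + c) = min a b + c" "min (c + a) (c + b) = c + min a b" for a b c :: int
    by linarith+
  show ?thesis
    using cases unfolding Min unfolding eq l1 box_dist.simps insert_iff empty_iff prod.inject
    by (elim disjE conjE FalseE; simp only: gaps min_add min.idem)
qed

lemma silicate_cell:
  assumes "n \<ge> 1" "a \<in> pverts (silicate (circumcoronene n))"
  obtains l h where "cell a = {l, h}" "honeycomb_cell l h"
    "l \<in> pverts (circumcoronene n)" "h \<in> pverts (circumcoronene n)"
proof (cases a)
  case (Oxygen e)
  then obtain u v where e: "e = {u, v}" and uv: "u \<in> pverts (circumcoronene n)"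
      "v \<in> pverts (circumcoronene n)" "honeycomb_adj u v"
    using assms(2) unfolding pverts_silicate
    by (auto simp: in_clique_iffs parcs_circumcoronene[OF assms(1)])
  obtain x y z x' y' z' where eq: "u = (x, y, z)" "v = (x', y', z')"
    by (metis prod_cases3)
  have "x + y + z \<in> {1..2}" "x' + y' + z' \<in> {1..2}"
    using uv unfolding eq pverts_circumcoronene[OF assms(1)] by auto
  moreover have "x + y + z \<noteq> x' + y' + z'"
    using uv(3) unfolding eq by auto
  ultimately consider "x + y + z = 1" "x' + y' + z' = 2" | "x + y + z = 2" "x' + y' + z' = 1"
    by fastforce
  then show ?thesis
  proof cases
    case 1
    then have "honeycomb_cell u v" using uv(3) unfolding honeycomb_cell_def eq by simp
    then show ?thesis using uv e Oxygen by (intro that[of u v]) simp_all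
  next
    case 2
    then have "honeycomb_cell v u"
      using honeycomb_adj_sym[OF uv(3)] unfolding honeycomb_cell_def eq by simp
    then show ?thesis using uv e Oxygen by (intro that[of v u]) (simp_all add: insert_commute)
  qed
next
  case (Silicon u)
  then show ?thesis
    using assms(2) that[of u u] unfolding pverts_silicate by (auto simp: in_clique_iffs honeycomb_cell_def)
next
  case (Pendant u)
  then show ?thesis
    using assms(2) that[of u u] unfolding pverts_silicate by (auto simp: in_clique_iffs honeycomb_cell_def)
qed

lemma honeycomb_cell_eqI:
  assumes "n \<ge> 1" "honeycomb_cell l h" "honeycomb_cell l' h'"
    and V: "{l, h, l', h'} \<subseteq> pverts (circumcoronene n)"
    and eq: "\<And>s. s \<in> pverts (circumcoronene n) \<Longrightarrow> on_boundary (int n) s \<Longrightarrow> box_dist s l h = box_dist s l' h'"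
  shows "l = l' \<and> h = h'"
proof -
  let ?N = "int n"
  obtain l1 l2 l3 h1 h2 h3 l1' l2' l3' h1' h2' h3'
    where c: "l = (l1, l2, l3)" "h = (h1, h2, h3)" "l' = (l1', l2', l3')" "h' = (h1', h2', h3')"
    by (metis prod_cases3)
  have box: "l1 \<le> h1" "l2 \<le> h2" "l3 \<le> h3" "1 \<le> l1 + l2 + l3" "h1 + h2 + h3 \<le> 2"
      "1 - ?N \<le> l1" "1 - ?N \<le> l2" "1 - ?N \<le> l3" "h1 \<le> ?N" "h2 \<le> ?N" "h3 \<le> ?N"
    using assms(2) V unfolding honeycomb_cell_def c pverts_circumcoronene[OF assms(1)] by auto
  have box': "l1' \<le> h1'" "l2' \<le> h2'" "l3' \<le> h3'" "1 \<le> l1' + l2' + l3'" "h1' + h2' + h3' \<le> 2"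
      "1 - ?N \<le> l1'" "1 - ?N \<le> l2'" "1 - ?N \<le> l3'" "h1' \<le> ?N" "h2' \<le> ?N" "h3' \<le> ?N"
    using assms(3) V unfolding honeycomb_cell_def c pverts_circumcoronene[OF assms(1)] by auto
  have N: "1 \<le> ?N" using assms(1) by simp
  \<comment> \<open>The six sides of the boundary, parametrised by \<open>t\<close>; the last three
    are the reflections of the first three.\<close>
  have side: "box_dist s l h = box_dist s l' h'"
    if "s \<in> {(?N, t, 1 - ?N - t), (1 - ?N - t, ?N, t), (t, 1 - ?N - t, ?N),
      (1 - ?N, 1 - t, ?N + t), (?N + t, 1 - ?N, 1 - t), (1 - t, ?N + t, 1 - ?N)}" "t \<in> {1 - ?N..0}" for s t
    using that N by (intro eq) (auto simp: pverts_circumcoronene[OF assms(1)])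
  \<comment> \<open>This turns a side with sum 2 into one with sum 1 for the reflected box, whose
    lower corner is \<open>1 - h\<close>.\<close>
  have flip: "gap (1 - ?N) l h = gap ?N (1 - h) (1 - l)" "gap (1 - t) l h = gap t (1 - h) (1 - l)"
      "gap (?N + t) l h = gap (1 - ?N - t) (1 - h) (1 - l)" for t l h
    using gap_flip[of ?N "1 - l" "1 - h"] gap_flip[of t "1 - l" "1 - h"]
      gap_flip[of "1 - ?N - t" "1 - l" "1 - h"] by simp_all
  have sum1: "gap ?N l1 h1 + gap t l2 h2 + gap (1 - ?N - t) l3 h3 =
      gap ?N l1' h1' + gap t l2' h2' + gap (1 - ?N - t) l3' h3'" if "t \<in> {1 - ?N..0}" for t
    using side[OF _ that, of "(?N, t, 1 - ?N - t)"] unfolding c box_dist.simps by simp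
  have min1: "l2 + l3 - h1 = l2' + l3' - h1'"
    by (rule side_determines, erule sum1) (use box box' N in linarith)+
  have sum2: "gap ?N l2 h2 + gap t l3 h3 + gap (1 - ?N - t) l1 h1 =
      gap ?N l2' h2' + gap t l3' h3' + gap (1 - ?N - t) l1' h1'" if "t \<in> {1 - ?N..0}" for t
    using side[OF _ that, of "(1 - ?N - t, ?N, t)"] unfolding c box_dist.simps by simp
  have min2: "l3 + l1 - h2 = l3' + l1' - h2'"
    by (rule side_determines, erule sum2) (use box box' N in linarith)+
  have sum3: "gap ?N l3 h3 + gap t l1 h1 + gap (1 - ?N - t) l2 h2 =
      gap ?N l3' h3' + gap t l1' h1' + gap (1 - ?N - t) l2' h2'" if "t \<in> {1 - ?N..0}" for t
    using side[OF _ that, of "(t, 1 - ?N - t, ?N)"] unfolding c box_dist.simps by simp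
  have min3: "l1 + l2 - h3 = l1' + l2' - h3'"
    by (rule side_determines, erule sum3) (use box box' N in linarith)+
  have sum4: "gap ?N (1 - h1) (1 - l1) + gap t (1 - h2) (1 - l2) + gap (1 - ?N - t) (1 - h3) (1 - l3) =
      gap ?N (1 - h1') (1 - l1') + gap t (1 - h2') (1 - l2') + gap (1 - ?N - t) (1 - h3') (1 - l3')"
    if "t \<in> {1 - ?N..0}" for t
    using side[OF _ that, of "(1 - ?N, 1 - t, ?N + t)"] unfolding c box_dist.simps flip by simp
  have min4: "(1 - h2) + (1 - h3) - (1 - l1) = (1 - h2') + (1 - h3') - (1 - l1')"
    by (rule side_determines, erule sum4) (use box box' N in linarith)+
  have sum5: "gap ?N (1 - h2) (1 - l2) + gap t (1 - h3) (1 - l3) + gap (1 - ?N - t) (1 - h1) (1 - l1) =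
      gap ?N (1 - h2') (1 - l2') + gap t (1 - h3') (1 - l3') + gap (1 - ?N - t) (1 - h1') (1 - l1')"
    if "t \<in> {1 - ?N..0}" for t
    using side[OF _ that, of "(?N + t, 1 - ?N, 1 - t)"] unfolding c box_dist.simps flip by simp
  have min5: "(1 - h3) + (1 - h1) - (1 - l2) = (1 - h3') + (1 - h1') - (1 - l2')"
    by (rule side_determines, erule sum5) (use box box' N in linarith)+
  have sum6: "gap ?N (1 - h3) (1 - l3) + gap t (1 - h1) (1 - l1) + gap (1 - ?N - t) (1 - h2) (1 - l2) =
      gap ?N (1 - h3') (1 - l3') + gap t (1 - h1') (1 - l1') + gap (1 - ?N - t) (1 - h2') (1 - l2')"
    if "t \<in> {1 - ?N..0}" for t
    using side[OF _ that, of "(1 - t, ?N + t, 1 - ?N)"] unfolding c box_dist.simps flip by simp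
  have min6: "(1 - h1) + (1 - h2) - (1 - l3) = (1 - h1') + (1 - h2') - (1 - l3')"
    by (rule side_determines, erule sum6) (use box box' N in linarith)+
  show ?thesis
    using box_eqI[OF box(1-5) box'(1-5) min1 min2 min3] min4 min5 min6 unfolding c by simp
qed

theorem theorem3p4:
  fixes n :: nat
  assumes "n \<ge> 2"
  shows "ft_metric_dim (silicate_network n) = 12 * n"
proof -
  let ?G = "circumcoronene n"
  have n: "n \<ge> 1" using assms by simp
  have B: "s \<in> {s \<in> pverts ?G. out_degree ?G s = 2} \<longleftrightarrow> s \<in> pverts ?G \<and> on_boundary (int n) s" for s
    using out_degree_circumcoronene[OF n] by blast
  have "ft_metric_dim (silicate ?G) = 2 * card {s \<in> pverts ?G. out_degree ?G s = 2}"
  proof (rule ft_metric_dim_silicate[where D = l1_dist], goal_cases)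
    case 1
    show ?case by (rule pair_graph_circumcoronene)
  next
    case (2 s)
    show ?case by (cases s) simp
  next
    case (3 s u v)
    then show ?case using parcs_circumcoronene[OF n] by (intro l1_dist_lipschitz) blast
  next
    case (4 s u)
    then show ?case using l1_dist_descent[OF n] by blast
  next
    case (5 a b)
    obtain l h where a: "cell a = {l, h}" "honeycomb_cell l h" "l \<in> pverts ?G" "h \<in> pverts ?G"
      by (rule silicate_cell[OF n 5(1)])
    obtain l' h' where b: "cell b = {l', h'}" "honeycomb_cell l' h'" "l' \<in> pverts ?G" "h' \<in> pverts ?G"
      by (rule silicate_cell[OF n 5(2)])
    \<comment> \<open>Cells that differ have different boxes, so some boundary vertex has different
      distances to them.\<close>
    have "\<not> (l = l' \<and> h = h')" using 5(3) a(1) b(1) by auto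
    then obtain s where s: "s \<in> pverts ?G" "on_boundary (int n) s" "box_dist s l h \<noteq> box_dist s l' h'"
      using honeycomb_cell_eqI[OF n a(2) b(2)] a(3,4) b(3,4) by blast
    then have "Min (l1_dist s ` cell a) \<noteq> Min (l1_dist s ` cell b)"
      using Min_l1_dist_cell[OF a(2), of s] Min_l1_dist_cell[OF b(2), of s] unfolding a(1) b(1) by metis
    then show ?case using s B by blast
  qed
  also have "{s \<in> pverts ?G. out_degree ?G s = 2} = {s \<in> pverts ?G. on_boundary (int n) s}"
    using B by blast
  finally show ?thesis
    unfolding silicate_network_def card_boundary[OF n] by simp
qed

end
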